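(* Let $n\geq 2$ and $c\in\mathbb{C}^n$. The following assertions hold: (i) If $\sum_{j=1}^{n}c(j)\neq 0$, then $$\mathrm{circ}(c)^{\dagger}=\mathrm{circ}\left(c(1)-\frac{\sum_{j=1}^{n}c(j)}{n},\ldots,c(n)-\frac{\sum_{j=1}^{n}c(j)}{n}\right)^{\dagger}+\frac{1}{n\sum_{j=1}^{n}c(j)}ee^{t}.$$ (ii) If $\sum_{j=1}^{n}c(j)=0$ and $\alpha\in\mathbb{C}$, $\alpha\neq 0$, then $$\mathrm{circ}(c)^{\dagger}=\mathrm{circ}\left(c(1)+\alpha,\ldots,c(n)+\alpha\right)^{\dagger}-\frac{1}{n^{2}\alpha}ee^{t}.$$
   Context: For $c\in\mathbb{C}^n$, $\mathrm{circ}(c)$ is the $n\times n$ circulant matrix whose first row is $(c(1),\ldots,c(n))$ and each of whose subsequent rows is the cyclic right shift by one of the previous row. $e$ is the column vector in $\mathbb{C}^n$ with all components equal to $1$; $t$ denotes transpose. $A^{\dagger}$ is the Moore--Penrose inverse: the unique matrix $X$ with $AXA=A$, $XAX=X$, $(AX)^{*}=AX$, $(XA)^{*}=XA$. *)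

theory Defs
  imports "Jordan_Normal_Form.Schur_Decomposition"
begin

definition cyclic_right_shift :: "'a vec \<Rightarrow> 'a vec" where
  "cyclic_right_shift v = vec (dim_vec v) (\<lambda>j. v $ ((j + dim_vec v - 1) mod dim_vec v))"

text \<open>Vectors and matrices are indexed from 0, so that \<open>c $ j\<close> is the mathematical \<open>c(j+1)\<close>
  and row \<open>i\<close> is obtained from the first row by \<open>i\<close> shifts.\<close>

definition circ :: "'a vec \<Rightarrow> 'a mat" where
  "circ c = mat_of_rows (dim_vec c)
     (map (\<lambda>i. (cyclic_right_shift ^^ i) c) [0..<dim_vec c])"

definition ones_col :: "nat \<Rightarrow> 'a :: one mat" where
  "ones_col n = mat n 1 (\<lambda>_. 1)"

definition is_moore_penrose :: "complex mat \<Rightarrow> complex mat \<Rightarrow> bool" where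
  "is_moore_penrose A X \<longleftrightarrow>
     X \<in> carrier_mat (dim_col A) (dim_row A) \<and>
     A * X * A = A \<and> X * A * X = X \<and>
     mat_adjoint (A * X) = A * X \<and> mat_adjoint (X * A) = X * A"

definition moore_penrose :: "complex mat \<Rightarrow> complex mat" where
  "moore_penrose A = (THE X. is_moore_penrose A X)"

lemma dim_cyclic_right_shift [simp]: "dim_vec (cyclic_right_shift v) = dim_vec v"
  by (simp add: cyclic_right_shift_def)

lemma cyclic_right_shift_funpow:
  "(cyclic_right_shift ^^ i) c =
     vec (dim_vec c) (\<lambda>j. c $ nat ((int j - int i) mod int (dim_vec c)))"
proof (induction i)
  case 0
  show ?case by (rule eq_vecI) auto
next
  case (Suc i)
  show ?case
  proof (rule eq_vecI)
    fix j assume "j < dim_vec (vec (dim_vec c) (\<lambda>j. c $ nat ((int j - int (Suc i)) mod int (dim_vec c))))"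
    then have j: "j < dim_vec c" by simp
    have "int ((j + dim_vec c - 1) mod dim_vec c) = (int j + int (dim_vec c) - 1) mod int (dim_vec c)"
      using j by (simp add: zmod_int of_nat_diff)
    then have "(int ((j + dim_vec c - 1) mod dim_vec c) - int i) mod int (dim_vec c)
        = ((int j + int (dim_vec c) - 1) mod int (dim_vec c) - int i) mod int (dim_vec c)"
      by simp
    also have "\<dots> = (int j - int (Suc i) + int (dim_vec c)) mod int (dim_vec c)"
      by (simp add: mod_diff_left_eq algebra_simps)
    also have "\<dots> = (int j - int (Suc i)) mod int (dim_vec c)"
      by simp
    finally show "(cyclic_right_shift ^^ Suc i) c $ j =
        vec (dim_vec c) (\<lambda>j. c $ nat ((int j - int (Suc i)) mod int (dim_vec c))) $ j"
      using j by (simp add: Suc cyclic_right_shift_def)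
  qed (simp add: Suc)
qed

lemma circ_carrier: "c \<in> carrier_vec n \<Longrightarrow> circ c \<in> carrier_mat n n"
  by (auto simp: circ_def)

lemma circ_index:
  assumes "c \<in> carrier_vec n" "i < n" "j < n"
  shows "circ c $$ (i, j) = c $ nat ((int j - int i) mod int n)"
  using assms by (simp add: circ_def mat_of_rows_index cyclic_right_shift_funpow carrier_vecD)

lemma mat_adjoint_carrier: "A \<in> carrier_mat n m \<Longrightarrow> mat_adjoint A \<in> carrier_mat m n"
  by (auto simp: mat_adjoint_def)

lemma mat_adjoint_index:
  assumes "A \<in> carrier_mat n m" "i < m" "j < n"
  shows "mat_adjoint A $$ (i, j) = conjugate (A $$ (j, i))"
  using assms by (auto simp: mat_adjoint_def mat_of_rows_index)

lemma mat_adjoint_mult: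
  fixes A B :: "complex mat"
  assumes A: "A \<in> carrier_mat n m" and B: "B \<in> carrier_mat m k"
  shows "mat_adjoint (A * B) = mat_adjoint B * mat_adjoint A"
proof (rule eq_matI)
  have AB: "A * B \<in> carrier_mat n k" using A B by simp
  note cs = mat_adjoint_carrier[OF A] mat_adjoint_carrier[OF B] mat_adjoint_carrier[OF AB]
  show "dim_row (mat_adjoint (A * B)) = dim_row (mat_adjoint B * mat_adjoint A)"
    and "dim_col (mat_adjoint (A * B)) = dim_col (mat_adjoint B * mat_adjoint A)"
    using cs by auto
  fix i j assume "i < dim_row (mat_adjoint B * mat_adjoint A)"
    and "j < dim_col (mat_adjoint B * mat_adjoint A)"
  then have ij: "i < k" "j < n" using cs by auto
  have "mat_adjoint (A * B) $$ (i, j) = cnj (\<Sum>l = 0..<m. A $$ (j, l) * B $$ (l, i))"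
    using ij A B by (simp add: mat_adjoint_index[OF AB] scalar_prod_def)
  also have "\<dots> = (\<Sum>l = 0..<m. cnj (B $$ (l, i)) * cnj (A $$ (j, l)))"
    by (simp add: mult.commute)
  also have "\<dots> = (mat_adjoint B * mat_adjoint A) $$ (i, j)"
    using ij cs by (simp add: scalar_prod_def mat_adjoint_index[OF A] mat_adjoint_index[OF B])
  finally show "mat_adjoint (A * B) $$ (i, j) = (mat_adjoint B * mat_adjoint A) $$ (i, j)" .
qed

lemma is_moore_penrose_unique:
  assumes X: "is_moore_penrose A X" and Y: "is_moore_penrose A Y"
  shows "X = Y"
proof -
  define n m where "n = dim_row A" and "m = dim_col A"
  have cA: "A \<in> carrier_mat n m" by (auto simp: n_def m_def)
  have cX: "X \<in> carrier_mat m n" and cY: "Y \<in> carrier_mat m n"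
    using X Y by (auto simp: is_moore_penrose_def n_def m_def)
  note x = X[unfolded is_moore_penrose_def] and y = Y[unfolded is_moore_penrose_def]
  have cAX: "A * X \<in> carrier_mat n n" and cAY: "A * Y \<in> carrier_mat n n"
    and cXA: "X * A \<in> carrier_mat m m" and cYA: "Y * A \<in> carrier_mat m m"
    using cA cX cY by auto
  have "A * X = (A * Y) * (A * X)"
    using y cA cX cY by (metis assoc_mult_mat cAY)
  also have "\<dots> = mat_adjoint ((A * X) * (A * Y))"
    using x y by (simp add: mat_adjoint_mult[OF cAX cAY])
  also have "(A * X) * (A * Y) = A * Y"
    using x cA cX cY by (metis assoc_mult_mat cAX)
  finally have ax: "A * X = A * Y" using y by simp
  have "X * A = (X * A) * (Y * A)"
    using y cA cX cY by (metis assoc_mult_mat cYA)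
  also have "\<dots> = mat_adjoint ((Y * A) * (X * A))"
    using x y by (simp add: mat_adjoint_mult[OF cYA cXA])
  also have "(Y * A) * (X * A) = Y * A"
    using x cA cX cY by (metis assoc_mult_mat cXA)
  finally have xa: "X * A = Y * A" using y by simp
  have "X = Y * A * X" using x xa by simp
  also have "\<dots> = Y * (A * Y)" using assoc_mult_mat[OF cY cA cX] ax by simp
  also have "\<dots> = Y" using assoc_mult_mat[OF cY cA cY] y by simp
  finally show ?thesis .
qed

lemma moore_penrose_eqI: "is_moore_penrose A X \<Longrightarrow> moore_penrose A = X"
  unfolding moore_penrose_def using is_moore_penrose_unique by blast

end

theory Submission
  imports Defs
begin

text \<open>If \<open>B\<close> is a circulant matrix whose entries in a row sum to \<open>0\<close>, then \<open>B\<close> and \<open>\<beta> ee\<^sup>t\<close>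
  are star-orthogonal: \<open>B\<^sup>* (\<beta> ee\<^sup>t) = 0\<close> and \<open>B (\<beta> ee\<^sup>t)\<^sup>* = 0\<close>. The Moore--Penrose inverse is
  additive on star-orthogonal matrices, and that of \<open>\<beta> ee\<^sup>t\<close> is \<open>ee\<^sup>t / (n\<^sup>2 \<beta>)\<close>. Both assertions are
  this identity, with \<open>\<beta> = \<Sum>\<^sub>j c(j) / n\<close> and \<open>\<beta> = \<alpha>\<close> respectively. Existence of the
  Moore--Penrose inverse of a circulant matrix comes from its diagonalisation by the unitary
  Fourier matrix.\<close>

section \<open>Adjoints, and additivity of the Moore-Penrose inverse under
  star-orthogonality\<close>

lemma is_moore_penrose_carrier:
  "is_moore_penrose A X \<Longrightarrow> A \<in> carrier_mat n m \<Longrightarrow> X \<in> carrier_mat m n"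
  by (auto simp: is_moore_penrose_def)

lemma mat_adjoint_adjoint:
  fixes A :: "complex mat"
  shows "mat_adjoint (mat_adjoint A) = A"
  by (rule eq_matI) (auto simp: mat_adjoint_def mat_of_rows_index)

lemma mat_adjoint_zero: "mat_adjoint (0\<^sub>m n m :: complex mat) = 0\<^sub>m m n"
  by (rule eq_matI) (auto simp: mat_adjoint_def mat_of_rows_index)

lemma mat_adjoint_add:
  fixes A B :: "complex mat"
  assumes "A \<in> carrier_mat n m" "B \<in> carrier_mat n m"
  shows "mat_adjoint (A + B) = mat_adjoint A + mat_adjoint B"
  using assms by (intro eq_matI) (auto simp: mat_adjoint_def mat_of_rows_index)

text \<open>Since \<open>X * A\<close> is self-adjoint, \<open>X = X * A * X\<close> rewrites to
  \<open>mat_adjoint A * (mat_adjoint X * X)\<close>. So \<open>X\<close> has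
  \<open>mat_adjoint A\<close> as a left factor, and whatever annihilates that factor from the left
  annihilates \<open>X\<close>.\<close>

lemma mult_moore_penrose_eq_0:
  assumes X: "is_moore_penrose A X" and A: "A \<in> carrier_mat n m" and B: "B \<in> carrier_mat k m"
    and BA: "B * mat_adjoint A = 0\<^sub>m k n"
  shows "B * X = 0\<^sub>m k n"
proof -
  have cX: "X \<in> carrier_mat m n" using is_moore_penrose_carrier[OF X A] .
  note cs = A cX mat_adjoint_carrier[OF A] mat_adjoint_carrier[OF cX]
  have "X = mat_adjoint (X * A) * X" using X by (simp add: is_moore_penrose_def)
  also have "\<dots> = mat_adjoint A * mat_adjoint X * X" by (simp add: mat_adjoint_mult[OF cX A])
  also have "\<dots> = mat_adjoint A * (mat_adjoint X * X)" using cs by (intro assoc_mult_mat)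
  finally have "B * X = B * (mat_adjoint A * (mat_adjoint X * X))" by simp
  also have "\<dots> = B * mat_adjoint A * (mat_adjoint X * X)"
    using cs B by (intro assoc_mult_mat[symmetric]) auto
  finally show ?thesis using BA cs by simp
qed

text \<open>The mirror image: self-adjointness of \<open>A * X\<close> turns
  \<open>X = X * (A * X)\<close> into \<open>X * mat_adjoint X * mat_adjoint A\<close>, so
  \<open>mat_adjoint A\<close> is a right factor of \<open>X\<close>.\<close>

lemma moore_penrose_mult_eq_0:
  assumes X: "is_moore_penrose A X" and A: "A \<in> carrier_mat n m" and B: "B \<in> carrier_mat n k"
    and AB: "mat_adjoint A * B = 0\<^sub>m m k"
  shows "X * B = 0\<^sub>m m k"
proof -
  have cX: "X \<in> carrier_mat m n" using is_moore_penrose_carrier[OF X A] .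
  note cs = A cX mat_adjoint_carrier[OF A] mat_adjoint_carrier[OF cX]
  have "X = X * A * X" using X by (simp add: is_moore_penrose_def)
  also have "\<dots> = X * (A * X)" using cs by (intro assoc_mult_mat)
  also have "\<dots> = X * mat_adjoint (A * X)" using X by (simp add: is_moore_penrose_def)
  also have "\<dots> = X * (mat_adjoint X * mat_adjoint A)" by (simp add: mat_adjoint_mult[OF A cX])
  also have "\<dots> = X * mat_adjoint X * mat_adjoint A"
    using cs by (intro assoc_mult_mat[symmetric])
  finally have "X * B = X * mat_adjoint X * mat_adjoint A * B" by simp
  also have "\<dots> = X * mat_adjoint X * (mat_adjoint A * B)"
    using cs B by (intro assoc_mult_mat) auto
  finally show ?thesis using AB cs by simp
qed

lemma is_moore_penrose_add:
  assumes X: "is_moore_penrose B X" and Y: "is_moore_penrose C Y"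
    and B: "B \<in> carrier_mat n m" and C: "C \<in> carrier_mat n m"
    and BC: "mat_adjoint B * C = 0\<^sub>m m m" and BC': "B * mat_adjoint C = 0\<^sub>m n n"
  shows "is_moore_penrose (B + C) (X + Y)"
proof -
  have cX: "X \<in> carrier_mat m n" and cY: "Y \<in> carrier_mat m n"
    using is_moore_penrose_carrier[OF X B] is_moore_penrose_carrier[OF Y C] by auto
  note cs = B C cX cY
  \<comment> \<open>Taking adjoints makes star-orthogonality symmetric in \<open>B\<close> and
    \<open>C\<close>; with both versions at hand, all four mixed products of a matrix with the
    inverse of the other one vanish.\<close>
  have CB: "mat_adjoint C * B = 0\<^sub>m m m"
    using arg_cong[OF BC, of mat_adjoint]
    by (simp add: mat_adjoint_mult[OF mat_adjoint_carrier[OF B] C] mat_adjoint_adjoint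
        mat_adjoint_zero)
  have CB': "C * mat_adjoint B = 0\<^sub>m n n"
    using arg_cong[OF BC', of mat_adjoint]
    by (simp add: mat_adjoint_mult[OF B mat_adjoint_carrier[OF C]] mat_adjoint_adjoint
        mat_adjoint_zero)
  have z: "B * Y = 0\<^sub>m n n" "C * X = 0\<^sub>m n n" "X * C = 0\<^sub>m m m" "Y * B = 0\<^sub>m m m"
    using mult_moore_penrose_eq_0[OF Y C B BC'] mult_moore_penrose_eq_0[OF X B C CB']
      moore_penrose_mult_eq_0[OF X B C BC] moore_penrose_mult_eq_0[OF Y C B CB] by auto
  have l: "(B + C) * (X + Y) = B * X + C * Y"
    using cs z by (simp add: add_mult_distrib_mat[of _ n m _ _ n] mult_add_distrib_mat[of _ n m _ n])
  have r: "(X + Y) * (B + C) = X * B + Y * C"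
    using cs z by (simp add: add_mult_distrib_mat[of _ m n _ _ m] mult_add_distrib_mat[of _ m n _ m])
  note x = X[unfolded is_moore_penrose_def] and y = Y[unfolded is_moore_penrose_def]
  have z2: "B * X * C = 0\<^sub>m n m" "C * Y * B = 0\<^sub>m n m" "X * B * Y = 0\<^sub>m m n" "Y * C * X = 0\<^sub>m m n"
    using assoc_mult_mat[OF B cX C] assoc_mult_mat[OF C cY B]
      assoc_mult_mat[OF cX B cY] assoc_mult_mat[OF cY C cX] cs z by auto
  \<comment> \<open>Only the pure terms survive, so the Penrose equations of the sum split into
    those of the two summands.\<close>
  have "(B + C) * (X + Y) * (B + C) = (B * X * B + C * Y * B) + (B * X * C + C * Y * C)"
    unfolding l using cs
    by (simp add: add_mult_distrib_mat[of _ n n _ _ m] mult_add_distrib_mat[of _ n n _ m])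
  also have "\<dots> = B + C" using z2 x y cs by simp
  finally have 1: "(B + C) * (X + Y) * (B + C) = B + C" .
  have "(X + Y) * (B + C) * (X + Y) = (X * B * X + Y * C * X) + (X * B * Y + Y * C * Y)"
    unfolding r using cs
    by (simp add: add_mult_distrib_mat[of _ m m _ _ n] mult_add_distrib_mat[of _ m m _ n])
  also have "\<dots> = X + Y" using z2 x y cs by simp
  finally have 2: "(X + Y) * (B + C) * (X + Y) = X + Y" .
  show ?thesis unfolding is_moore_penrose_def 1 2 unfolding l r
    using cs x y by (simp add: mat_adjoint_add[of _ n n] mat_adjoint_add[of _ m m])
qed

section \<open>Unitary similarity and diagonal matrices\<close>

lemma is_moore_penrose_unitary_similar:
  assumes Y: "is_moore_penrose D Y" and D: "D \<in> carrier_mat n n" and U: "U \<in> carrier_mat n n"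
    and UU: "mat_adjoint U * U = 1\<^sub>m n"
  shows "is_moore_penrose (U * D * mat_adjoint U) (U * Y * mat_adjoint U)"
proof -
  define V where "V = mat_adjoint U"
  have cY: "Y \<in> carrier_mat n n" using is_moore_penrose_carrier[OF Y D] .
  have V: "V \<in> carrier_mat n n" using mat_adjoint_carrier[OF U] by (simp add: V_def)
  have VU: "V * U = 1\<^sub>m n" using UU by (simp add: V_def)
  \<comment> \<open>The inner \<open>V * U\<close> cancels, so conjugation by \<open>U\<close> is
    multiplicative. It also commutes with the adjoint, as shown next, and therefore transports all
    four Penrose equations.\<close>
  have mult: "U * P * V * (U * Q * V) = U * (P * Q) * V"
    if P: "P \<in> carrier_mat n n" and Q: "Q \<in> carrier_mat n n" for P Q
  proof -
    have "U * P * V * (U * Q * V) = U * P * (V * U) * (Q * V)"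
      using U V P Q by (simp add: assoc_mult_mat[of _ n n _ n _ n])
    also have "\<dots> = U * (P * Q) * V"
      unfolding VU using U V P Q by (simp add: assoc_mult_mat[of _ n n _ n _ n])
    finally show ?thesis .
  qed
  have adj: "mat_adjoint (U * P * V) = U * mat_adjoint P * V" if P: "P \<in> carrier_mat n n" for P
    using U V P mat_adjoint_carrier[OF P]
    by (simp add: mat_adjoint_mult[of _ n n _ n] V_def mat_adjoint_adjoint
        assoc_mult_mat[of _ n n _ n _ n])
  note y = Y[unfolded is_moore_penrose_def]
  have "U * D * V * (U * Y * V) = U * (D * Y) * V" "U * Y * V * (U * D * V) = U * (Y * D) * V"
    using D cY by (auto intro: mult)
  moreover have "U * (D * Y) * V * (U * D * V) = U * D * V" "U * (Y * D) * V * (U * Y * V) = U * Y * V"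
    using y mult[of "D * Y" D] mult[of "Y * D" Y] D cY by auto
  moreover have "mat_adjoint (U * (D * Y) * V) = U * (D * Y) * V"
    "mat_adjoint (U * (Y * D) * V) = U * (Y * D) * V"
    using y adj[of "D * Y"] adj[of "Y * D"] D cY by auto
  ultimately show ?thesis using U V D cY
    by (auto simp: is_moore_penrose_def V_def[symmetric] simp del: assoc_mult_mat)
qed

text \<open>The convention \<open>inverse 0 = 0\<close> makes the entrywise inverse correct for
  vanishing entries too: \<open>f i * inverse (f i)\<close> is always 0 or 1, hence real.\<close>

lemma is_moore_penrose_mat_diag:
  "is_moore_penrose (mat_diag n f) (mat_diag n (\<lambda>i. inverse (f i)))"
proof -
  have "mat_adjoint (mat_diag n g) = mat_diag n (\<lambda>i. cnj (g i))" for g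
    by (rule eq_matI) (auto simp: mat_adjoint_def mat_of_rows_index mat_diag_def)
  moreover have "cnj (f i * inverse (f i)) = f i * inverse (f i)" for i
    by (cases "f i = 0") auto
  moreover have "f i * inverse (f i) * f i = f i"
    "inverse (f i) * f i * inverse (f i) = inverse (f i)" for i
    by (cases "f i = 0"; simp)+
  moreover have "mat_diag n g \<in> carrier_mat (dim_col (mat_diag n f)) (dim_row (mat_diag n f))" for g
    by (simp add: mat_diag_def)
  ultimately show ?thesis
    by (simp only: is_moore_penrose_def mat_diag_diag mult.commute[of "inverse (f _)" "f _"])
       simp
qed

section \<open>The unitary Fourier matrix and the diagonalisation of circulant matrices\<close>

definition fourier_mat :: "nat \<Rightarrow> complex mat" where
  "fourier_mat n = mat n n (\<lambda>(j, k). cis (2 * pi * real k / real n) ^ j / of_real (sqrt (real n)))"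

lemma fourier_mat_carrier: "fourier_mat n \<in> carrier_mat n n"
  by (simp add: fourier_mat_def)

text \<open>Up to the factor 1/n, entry (i, j) is a geometric sum whose ratio
  \<open>cnj (z i) * z j\<close> is an n-th root of unity. The ratio is 1 for i = j; otherwise it
  differs from 1, because the roots \<open>z k\<close> are distinct, and the sum is 0.\<close>

lemma fourier_mat_unitary: "mat_adjoint (fourier_mat n) * fourier_mat n = 1\<^sub>m n"
proof (rule eq_matI)
  show "dim_row (mat_adjoint (fourier_mat n) * fourier_mat n) = dim_row (1\<^sub>m n)"
    and "dim_col (mat_adjoint (fourier_mat n) * fourier_mat n) = dim_col (1\<^sub>m n)"
    by (auto simp: mat_adjoint_def fourier_mat_def)
  fix i j assume "i < dim_row (1\<^sub>m n :: complex mat)" "j < dim_col (1\<^sub>m n :: complex mat)"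
  then have ij: "i < n" "j < n" by auto
  then have n: "n > 0" by simp
  define z where "z k = cis (2 * pi * real k / real n)" for k
  have bij: "bij_betw z {..<n} {z. z ^ n = 1}"
    unfolding z_def by (rule bij_betw_roots_unity[OF n])
  have z1: "z k ^ n = 1" if "k < n" for k
    using bij that by (auto simp: bij_betw_def)
  have zz: "cnj (z k) * z k = 1" for k
    by (simp add: z_def cis_cnj cis_mult)
  have sq: "complex_of_real (sqrt (real n)) * complex_of_real (sqrt (real n)) = of_nat n"
    by (simp flip: of_real_mult)
  have "(mat_adjoint (fourier_mat n) * fourier_mat n) $$ (i, j)
      = (\<Sum>l<n. cnj (z i ^ l / of_real (sqrt (real n))) * (z j ^ l / of_real (sqrt (real n))))"
    using ij fourier_mat_carrier[of n] mat_adjoint_carrier[OF fourier_mat_carrier[of n]]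
    by (simp add: scalar_prod_def mat_adjoint_index[OF fourier_mat_carrier] atLeast0LessThan)
       (simp add: fourier_mat_def z_def)
  also have "\<dots> = (\<Sum>l<n. (cnj (z i) * z j) ^ l) / of_nat n"
    by (simp add: sum_divide_distrib power_mult_distrib sq)
  also have "\<dots> = (if i = j then 1 else 0)"
  proof (cases "i = j")
    case True
    then show ?thesis using n by (simp add: zz)
  next
    case False
    have "cnj (z i) * z j \<noteq> 1"
    proof
      assume "cnj (z i) * z j = 1"
      then have "z i = z j" using zz[of i] by (metis mult_cancel_left mult_zero_left zero_neq_one)
      then show False using False ij bij by (auto simp: bij_betw_def inj_on_def)
    qed
    moreover have "(cnj (z i) * z j) ^ n = 1"
      using z1[OF ij(1)] z1[OF ij(2)] by (simp add: power_mult_distrib flip: complex_cnj_power)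
    ultimately show ?thesis using False by (simp add: geometric_sum)
  qed
  finally show "(mat_adjoint (fourier_mat n) * fourier_mat n) $$ (i, j) = 1\<^sub>m n $$ (i, j)"
    using ij by simp
qed

text \<open>Substitution j = (m + i) mod n along row i of a circulant. The second argument of
  \<open>f\<close> keeps the original column index, on which the weights of an eigenvector
  depend.\<close>

lemma sum_cyclic_shift:
  assumes "i < n"
  shows "(\<Sum>j<n. f (nat ((int j - int i) mod int n)) j) = (\<Sum>m<n. f m ((m + i) mod n))"
proof -
  have 1: "(nat ((int j - int i) mod int n) + i) mod n = j" if "j < n" for j
  proof -
    have "int ((nat ((int j - int i) mod int n) + i) mod n) = ((int j - int i) mod int n + int i) mod int n"
      using that by (simp add: zmod_int)
    also have "\<dots> = int j" using that by (simp add: mod_add_left_eq)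
    finally show ?thesis by simp
  qed
  have 2: "nat ((int ((m + i) mod n) - int i) mod int n) = m" if "m < n" for m
    using that by (simp add: zmod_int mod_diff_left_eq)
  show ?thesis
    using assms by (intro sum.reindex_bij_witness[of _ "\<lambda>m. (m + i) mod n" "\<lambda>j. nat ((int j - int i) mod int n)"])
      (auto simp: 1 2 nat_less_iff)
qed

text \<open>For fixed j, the map sending i to (j - i) mod n is an involution of the indices; this
  handles sums down a column of a circulant.\<close>

lemma sum_cyclic_reflection:
  assumes "j < n"
  shows "(\<Sum>i<n. f (nat ((int j - int i) mod int n))) = (\<Sum>m<n. f m)"
proof -
  have "nat ((int j - int (nat ((int j - int m) mod int n))) mod int n) = m" if "m < n" for m
    using that by (simp add: mod_diff_right_eq)
  then show ?thesis
    using assms by (intro sum.reindex_bij_witness[of _ "\<lambda>i. nat ((int j - int i) mod int n)"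
          "\<lambda>i. nat ((int j - int i) mod int n)"]) (auto simp: nat_less_iff)
qed

text \<open>The columns of the Fourier matrix are eigenvectors of every circulant: column k consists
  of scaled powers of a root of unity z, and a cyclic shift of it only multiplies it by a power of
  z. The eigenvalue is the polynomial with coefficients \<open>c\<close> evaluated at z.\<close>

lemma circ_eq_fourier:
  assumes c: "c \<in> carrier_vec n"
  shows "circ c = fourier_mat n
    * mat_diag n (\<lambda>k. \<Sum>m<n. c $ m * cis (2 * pi * real k / real n) ^ m)
    * mat_adjoint (fourier_mat n)"
    (is "_ = ?F * ?D * _")
proof -
  have cF: "?F \<in> carrier_mat n n" by (rule fourier_mat_carrier)
  have cF': "mat_adjoint ?F \<in> carrier_mat n n" by (rule mat_adjoint_carrier[OF cF])
  have cC: "circ c \<in> carrier_mat n n" by (rule circ_carrier[OF c])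
  have "circ c * ?F = ?F * ?D"
  proof (rule eq_matI)
    show "dim_row (circ c * ?F) = dim_row (?F * ?D)" "dim_col (circ c * ?F) = dim_col (?F * ?D)"
      using cF cC by (auto simp: mat_diag_def)
    fix i k assume "i < dim_row (?F * ?D)" "k < dim_col (?F * ?D)"
    then have ik: "i < n" "k < n" using cF by (auto simp: mat_diag_def)
    define z where "z = cis (2 * pi * real k / real n)"
    have "z ^ n = 1" using bij_betw_roots_unity[of n] ik by (auto simp: bij_betw_def z_def)
    then have z_mod: "z ^ (a mod n) = z ^ a" for a
      by (metis mult_div_mod_eq power_add power_mult power_one mult_1)
    have "(circ c * ?F) $$ (i, k) = (\<Sum>j<n. circ c $$ (i, j) * (z ^ j / of_real (sqrt (real n))))"
      using ik cC cF by (simp add: scalar_prod_def atLeast0LessThan) (simp add: fourier_mat_def z_def)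
    also have "\<dots> = (\<Sum>j<n. c $ nat ((int j - int i) mod int n) * (z ^ j / of_real (sqrt (real n))))"
      using ik by (simp add: circ_index[OF c])
    also have "\<dots> = (\<Sum>m<n. c $ m * (z ^ ((m + i) mod n) / of_real (sqrt (real n))))"
      by (rule sum_cyclic_shift[OF ik(1)])
    also have "\<dots> = z ^ i / of_real (sqrt (real n)) * (\<Sum>m<n. c $ m * z ^ m)"
      by (simp add: z_mod power_add sum_distrib_left mult_ac)
    also have "\<dots> = (?F * ?D) $$ (i, k)"
      using ik by (simp add: mat_diag_mult_right[OF cF]) (simp add: fourier_mat_def z_def)
    finally show "(circ c * ?F) $$ (i, k) = (?F * ?D) $$ (i, k)" .
  qed
  then have "?F * ?D * mat_adjoint ?F = circ c * ?F * mat_adjoint ?F" by simp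
  also have "\<dots> = circ c * (?F * mat_adjoint ?F)" by (rule assoc_mult_mat[OF cC cF cF'])
  \<comment> \<open>For square matrices a left inverse is also a right inverse.\<close>
  also have "?F * mat_adjoint ?F = 1\<^sub>m n"
    by (rule mat_mult_left_right_inverse[OF cF' cF fourier_mat_unitary])
  finally show ?thesis using cC by simp
qed

text \<open>As \<open>moore_penrose\<close> is a definite description, its defining equations become
  available only once some witness exists; the diagonalisation supplies one.\<close>

lemma is_moore_penrose_circ:
  assumes "c \<in> carrier_vec n"
  shows "is_moore_penrose (circ c) (moore_penrose (circ c))"
proof -
  obtain X where X: "is_moore_penrose (circ c) X"
    unfolding circ_eq_fourier[OF assms]
    using is_moore_penrose_unitary_similar[OF is_moore_penrose_mat_diag mat_diag_dim
        fourier_mat_carrier fourier_mat_unitary] by blast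
  then show ?thesis by (simp add: moore_penrose_eqI)
qed

section \<open>Circulant and constant matrices, and the two assertions\<close>

lemma circ_mult_const:
  assumes "c \<in> carrier_vec n"
  shows "circ c * mat n n (\<lambda>_. \<beta>) = mat n n (\<lambda>_. (\<Sum>j<n. c $ j) * \<beta>)"
proof (rule eq_matI)
  fix i j
  assume "i < dim_row (mat n n (\<lambda>_. (\<Sum>j<n. c $ j) * \<beta>))"
    and "j < dim_col (mat n n (\<lambda>_. (\<Sum>j<n. c $ j) * \<beta>))"
  then have ij: "i < n" "j < n" by auto
  then show "(circ c * mat n n (\<lambda>_. \<beta>)) $$ (i, j) = mat n n (\<lambda>_. (\<Sum>j<n. c $ j) * \<beta>) $$ (i, j)"
    using circ_carrier[OF assms] sum_cyclic_shift[OF ij(1), of "\<lambda>m _. c $ m"]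
    by (simp add: scalar_prod_def atLeast0LessThan circ_index[OF assms] flip: sum_distrib_right)
qed (use circ_carrier[OF assms] in auto)

lemma mat_adjoint_circ_mult_const:
  assumes "c \<in> carrier_vec n"
  shows "mat_adjoint (circ c) * mat n n (\<lambda>_. \<beta>) = mat n n (\<lambda>_. cnj (\<Sum>j<n. c $ j) * \<beta>)"
proof (rule eq_matI)
  note cs = circ_carrier[OF assms] mat_adjoint_carrier[OF circ_carrier[OF assms]]
  fix i j
  assume "i < dim_row (mat n n (\<lambda>_. cnj (\<Sum>j<n. c $ j) * \<beta>))"
    and "j < dim_col (mat n n (\<lambda>_. cnj (\<Sum>j<n. c $ j) * \<beta>))"
  then have ij: "i < n" "j < n" by auto
  then show "(mat_adjoint (circ c) * mat n n (\<lambda>_. \<beta>)) $$ (i, j) = mat n n (\<lambda>_. cnj (\<Sum>j<n. c $ j) * \<beta>) $$ (i, j)"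
    using cs sum_cyclic_reflection[OF ij(1), of "\<lambda>m. cnj (c $ m)"]
    by (simp add: scalar_prod_def atLeast0LessThan circ_index[OF assms]
        mat_adjoint_index[OF cs(1)] flip: sum_distrib_right)
qed (use mat_adjoint_carrier[OF circ_carrier[OF assms]] in auto)

lemma mat_adjoint_const: "mat_adjoint (mat n m (\<lambda>_. \<beta> :: complex)) = mat m n (\<lambda>_. cnj \<beta>)"
  by (rule eq_matI) (auto simp: mat_adjoint_def mat_of_rows_index)

text \<open>The all-ones matrix J satisfies J * J = n J, which accounts for the factor n squared.
  For \<beta> = 0 division by zero gives 0, so both matrices are zero.\<close>

lemma is_moore_penrose_const:
  "is_moore_penrose (mat n n (\<lambda>_. \<beta>)) (mat n n (\<lambda>_. 1 / ((of_nat n)\<^sup>2 * \<beta>)))"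
proof -
  have mult: "mat n n (\<lambda>_. x) * mat n n (\<lambda>_. y) = mat n n (\<lambda>_. of_nat n * x * y)" for x y :: complex
    by (rule eq_matI) (auto simp: scalar_prod_def)
  show ?thesis
  proof (cases "n = 0")
    case True
    then show ?thesis by (auto simp: is_moore_penrose_def mat_adjoint_def intro!: eq_matI)
  next
    case False
    then show ?thesis
      by (cases "\<beta> = 0") (auto simp: is_moore_penrose_def mult mat_adjoint_const power2_eq_square)
  qed
qed

lemma circ_add_const:
  assumes "c \<in> carrier_vec n"
  shows "circ (vec n (\<lambda>i. c $ i + \<beta>)) = circ c + mat n n (\<lambda>_. \<beta>)"
proof (rule eq_matI)
  fix i j assume "i < dim_row (circ c + mat n n (\<lambda>_. \<beta>))" "j < dim_col (circ c + mat n n (\<lambda>_. \<beta>))"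
  then have "i < n" "j < n" by auto
  then show "circ (vec n (\<lambda>i. c $ i + \<beta>)) $$ (i, j) = (circ c + mat n n (\<lambda>_. \<beta>)) $$ (i, j)"
    using circ_carrier[OF assms] by (simp add: circ_index[of _ n] assms nat_less_iff)
qed (use circ_carrier[OF assms] circ_carrier[of "vec n (\<lambda>i. c $ i + \<beta>)" n] in auto)

text \<open>The two orthogonality conditions are the vanishing of the row sums of
  \<open>circ c\<close> and of its conjugated column sums; all of these reduce to
  \<open>sum0\<close>. The value \<beta> = 0 is covered as well.\<close>

lemma moore_penrose_circ_add_const:
  assumes c: "c \<in> carrier_vec n" and sum0: "(\<Sum>j<n. c $ j) = 0"
  shows "moore_penrose (circ (vec n (\<lambda>i. c $ i + \<beta>)))
    = moore_penrose (circ c) + mat n n (\<lambda>_. 1 / ((of_nat n)\<^sup>2 * \<beta>))"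
proof -
  have zero: "mat n n (\<lambda>_. 0) = (0\<^sub>m n n :: complex mat)" by (simp add: zero_mat_def)
  have "is_moore_penrose (circ c + mat n n (\<lambda>_. \<beta>))
      (moore_penrose (circ c) + mat n n (\<lambda>_. 1 / ((of_nat n)\<^sup>2 * \<beta>)))"
    by (rule is_moore_penrose_add[OF is_moore_penrose_circ[OF c] is_moore_penrose_const
          circ_carrier[OF c]])
      (simp_all add: mat_adjoint_const mat_adjoint_circ_mult_const[OF c] circ_mult_const[OF c]
        sum0 zero)
  then show ?thesis unfolding circ_add_const[OF c] by (rule moore_penrose_eqI)
qed

lemma smult_ones_col_transpose:
  "k \<cdot>\<^sub>m (ones_col n * transpose_mat (ones_col n)) = mat n n (\<lambda>_. k :: complex)"
  by (rule eq_matI) (auto simp: ones_col_def scalar_prod_def)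

theorem proposition4p6:
  fixes n :: nat and c :: "complex vec"
  assumes "n \<ge> 2" and "c \<in> carrier_vec n"
  shows "((\<Sum>j<n. c $ j) \<noteq> 0 \<longrightarrow>
           moore_penrose (circ c) =
             moore_penrose (circ (vec n (\<lambda>i. c $ i - (\<Sum>j<n. c $ j) / of_nat n))) +
             (1 / (of_nat n * (\<Sum>j<n. c $ j))) \<cdot>\<^sub>m (ones_col n * transpose_mat (ones_col n)))
       \<and> (\<forall>\<alpha>::complex. (\<Sum>j<n. c $ j) = 0 \<and> \<alpha> \<noteq> 0 \<longrightarrow>
           moore_penrose (circ c) =
             moore_penrose (circ (vec n (\<lambda>i. c $ i + \<alpha>))) -
             (1 / ((of_nat n)\<^sup>2 * \<alpha>)) \<cdot>\<^sub>m (ones_col n * transpose_mat (ones_col n)))"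
proof (intro conjI allI impI)
  let ?s = "\<Sum>j<n. c $ j"
  let ?b = "vec n (\<lambda>i. c $ i - ?s / of_nat n)"
  have b: "?b \<in> carrier_vec n" by simp
  \<comment> \<open>Subtracting the mean centres the vector; adding it back is a shift by \<beta> =
    \<open>?s / of_nat n\<close>, for which n squared times \<beta> is n times
    \<open>?s\<close>.\<close>
  have "(\<Sum>j<n. ?b $ j) = 0" using assms(1) by (simp add: sum_subtractf)
  moreover have "vec n (\<lambda>i. ?b $ i + ?s / of_nat n) = c"
    using assms(2) by (intro eq_vecI) auto
  moreover have "(of_nat n)\<^sup>2 * (?s / of_nat n) = of_nat n * ?s"
    using assms(1) by (simp add: power2_eq_square)
  ultimately show "moore_penrose (circ c) = moore_penrose (circ ?b) +
      (1 / (of_nat n * ?s)) \<cdot>\<^sub>m (ones_col n * transpose_mat (ones_col n))"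
    using moore_penrose_circ_add_const[OF b, of "?s / of_nat n"]
    unfolding smult_ones_col_transpose by simp
next
  fix \<alpha> :: complex
  assume "(\<Sum>j<n. c $ j) = 0 \<and> \<alpha> \<noteq> 0"
  \<comment> \<open>The dimensions are required for cancelling the constant matrix entrywise in (M +
    K) - K = M.\<close>
  moreover have "moore_penrose (circ c) \<in> carrier_mat n n"
    using is_moore_penrose_carrier[OF is_moore_penrose_circ circ_carrier] assms(2) by blast
  ultimately show "moore_penrose (circ c) = moore_penrose (circ (vec n (\<lambda>i. c $ i + \<alpha>))) -
      (1 / ((of_nat n)\<^sup>2 * \<alpha>)) \<cdot>\<^sub>m (ones_col n * transpose_mat (ones_col n))"
    unfolding smult_ones_col_transpose
    by (intro eq_matI) (auto simp: moore_penrose_circ_add_const[OF assms(2)])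
qed

end
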